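(* Let $0<a<1$ and $0\le b<1$, and let $\rho$ be the rotation number of $f_\pm$. Let $(x_n)_{n\ge0}$ be any orbit of $f_\pm$, with any initial point $x_0\in[0,1]$. Then, as $n\to\infty$, $$\frac1n\sum_{i=0}^{n-1}x_i\to\chi:=\frac{b-\rho}{1-a}.$$
   Context: For real $x$ let $\{x\}:=x-\lfloor x\rfloor\in[0,1)$ and $\{x\}_+:=1-\{-x\}\in(0,1]$. For constants $0<a<1$, $0\le b<1$ define $f_-,f_+:[0,1]\to[0,1]$ by $f_-(x)=\{ax+b\}$, $f_+(x)=\{ax+b\}_+$, and let $f_\pm$ be the multi-valued map $x\mapsto\{f_-(x),f_+(x)\}$. An orbit of $f_\pm$ is any sequence $(x_n)_{n\ge0}$ in $[0,1]$ with $x_{n+1}\in f_\pm(x_n)$ for all $n\ge0$. Rotation number: let $F_-(x):=ax+b+(1-a)\lfloor x\rfloor$ and $F_+(x):=ax+b-(1-a)\lfloor 1-x\rfloor$ for $x\in\mathbb R$. The rotation number $\rho=\rho(a,b)\in[0,1)$ of $f_\pm$ is the number such that $F_-^n(x)/n\to\rho$ and $F_+^n(x)/n\to\rho$ as $n\to\infty$ for every $x\in\mathbb R$ (the limits exist, coincide and do not depend on $x$). *)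

theory Defs
  imports Complex_Main
begin

definition frac_plus :: "real \<Rightarrow> real"
  where "frac_plus x = 1 - frac (- x)"

definition f_minus :: "real \<Rightarrow> real \<Rightarrow> real \<Rightarrow> real"
  where "f_minus a b x = frac (a * x + b)"

definition f_plus :: "real \<Rightarrow> real \<Rightarrow> real \<Rightarrow> real"
  where "f_plus a b x = frac_plus (a * x + b)"

definition f_pm :: "real \<Rightarrow> real \<Rightarrow> real \<Rightarrow> real set"
  where "f_pm a b x = {f_minus a b x, f_plus a b x}"

text \<open>The maps are given by total functions on the reals; the restriction to the unit interval
  is imposed on the orbits.\<close>

definition is_orbit :: "real \<Rightarrow> real \<Rightarrow> (nat \<Rightarrow> real) \<Rightarrow> bool"
  where "is_orbit a b x \<longleftrightarrow> (\<forall>n. x n \<in> {0..1}) \<and> (\<forall>n. x (Suc n) \<in> f_pm a b (x n))"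

definition F_minus :: "real \<Rightarrow> real \<Rightarrow> real \<Rightarrow> real"
  where "F_minus a b x = a * x + b + (1 - a) * of_int \<lfloor>x\<rfloor>"

definition F_plus :: "real \<Rightarrow> real \<Rightarrow> real \<Rightarrow> real"
  where "F_plus a b x = a * x + b - (1 - a) * of_int \<lfloor>1 - x\<rfloor>"

definition is_rotation_number :: "real \<Rightarrow> real \<Rightarrow> real \<Rightarrow> bool"
  where "is_rotation_number a b \<rho> \<longleftrightarrow>
    \<rho> \<in> {0..<1} \<and>
    (\<forall>x. (\<lambda>n. (F_minus a b ^^ n) x / real n) \<longlonglongrightarrow> \<rho>) \<and>
    (\<forall>x. (\<lambda>n. (F_plus a b ^^ n) x / real n) \<longlonglongrightarrow> \<rho>)"

text \<open>Existence is not assumed: a proof about \<open>rotation_number\<close> has to show that the limits exist,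
  coincide and do not depend on the starting point.\<close>

definition rotation_number :: "real \<Rightarrow> real \<Rightarrow> real"
  where "rotation_number a b = (THE \<rho>. is_rotation_number a b \<rho>)"

end

theory Submission
  imports Defs
begin

text \<open>An orbit of the multi-valued circle map satisfies \<open>x\<^sub>n\<^sub>+\<^sub>1 = a x\<^sub>n + b - k\<^sub>n\<close> with integers \<open>k\<^sub>n\<close>,
  so summing up expresses \<open>(1 - a) \<Sum> x\<^sub>i\<close> through \<open>K\<^sub>n = \<Sum> k\<^sub>i\<close> up to a bounded error, and the claim
  becomes \<open>K\<^sub>n / n \<longlonglongrightarrow> \<rho>\<close>. Now \<open>y\<^sub>n = x\<^sub>n + K\<^sub>n\<close> moves by \<open>F\<^sub>-\<close> or \<open>F\<^sub>+\<close> at each step. Both lifts are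
  the same strictly increasing function of degree one away from its jumps at the integers, so
  every such \<open>y\<close> stays within bounded distance of \<open>u\<^sub>n = F\<^sub>-\<^sup>n(0)\<close>. Finally, \<open>u\<close> is additive up to
  an error of at most 1, which makes \<open>u\<^sub>n / n\<close> a Cauchy sequence.\<close>

text \<open>Each of the \<open>n\<close> additions of \<open>m\<close> costs at most
  \<open>C\<close>; the extra \<open>C\<close> pays for \<open>u 0\<close> in the base case.\<close>

lemma quasi_additive_mult:
  fixes u :: "nat \<Rightarrow> real"
  assumes "\<And>m n. \<bar>u (m + n) - u m - u n\<bar> \<le> C"
  shows "\<bar>u (n * m) - real n * u m\<bar> \<le> (real n + 1) * C"
proof (induction n)
  case 0
  show ?case using assms[of 0 0] by simp
next
  case (Suc n)
  show ?case
    using Suc.IH assms[of m "n * m"] by (simp add: algebra_simps abs_le_iff)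
qed

lemma quasi_additive_convergent:
  fixes u :: "nat \<Rightarrow> real"
  assumes qa: "\<And>m n. \<bar>u (m + n) - u m - u n\<bar> \<le> C"
  shows "convergent (\<lambda>n. u n / real n)"
proof -
  have C: "0 \<le> C" using qa[of 0 0] by linarith
  have *: "\<bar>u (n * m) / real (n * m) - u m / real m\<bar> \<le> 2 * C / real m" if "m > 0" "n > 0" for m n
  proof -
    have "u (n * m) / real (n * m) - u m / real m = (u (n * m) - real n * u m) / real (n * m)"
      using that by (simp add: field_simps)
    then have "\<bar>u (n * m) / real (n * m) - u m / real m\<bar>
        = \<bar>u (n * m) - real n * u m\<bar> / real (n * m)"
      by simp
    also have "\<dots> \<le> (2 * real n * C) / real (n * m)"
    proof (rule divide_right_mono)
      have "(real n + 1) * C \<le> (2 * real n) * C"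
        using that C by (intro mult_right_mono) auto
      then show "\<bar>u (n * m) - real n * u m\<bar> \<le> 2 * real n * C"
        using quasi_additive_mult[of u C n m] qa by force
    qed simp
    also have "\<dots> = 2 * C / real m" using that by simp
    finally show ?thesis .
  qed
  \<comment> \<open>The quotient at the common multiple \<open>n * m\<close> is close to both
    quotients.\<close>
  have **: "\<bar>u m / real m - u n / real n\<bar> \<le> 2 * C / real m + 2 * C / real n"
    if "m > 0" "n > 0" for m n
    using *[OF that] *[of n m] that by (simp add: mult.commute[of n m])
  have "Cauchy (\<lambda>n. u n / real n)"
  proof (rule metric_CauchyI)
    fix e :: real assume "0 < e"
    obtain N :: nat where N: "4 * C / e < real N" using reals_Archimedean2 by blast
    have small: "2 * C / real k < e / 2" if "k \<ge> Suc N" for k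
    proof -
      have "4 * C / e < real k" using N that by linarith
      moreover have "0 < real k" using that by simp
      ultimately show ?thesis using \<open>0 < e\<close> by (simp add: field_simps)
    qed
    show "\<exists>M. \<forall>m\<ge>M. \<forall>n\<ge>M. dist (u m / real m) (u n / real n) < e"
    proof (intro exI allI impI)
      fix m n assume mn: "Suc N \<le> m" "Suc N \<le> n"
      show "dist (u m / real m) (u n / real n) < e"
        unfolding dist_real_def using small[OF mn(1)] small[OF mn(2)] **[of m n] mn by linarith
    qed
  qed
  then show ?thesis by (rule Cauchy_convergent)
qed

lemma bounded_distance_same_rate:
  fixes u y :: "nat \<Rightarrow> real"
  assumes "(\<lambda>n. u n / real n) \<longlonglongrightarrow> r" and bound: "\<And>n. \<bar>y n - u n\<bar> \<le> B"
  shows "(\<lambda>n. y n / real n) \<longlonglongrightarrow> r"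
proof -
  have "(\<lambda>n. (y n - u n) / real n) \<longlonglongrightarrow> 0"
  proof (rule tendsto_0_le[OF lim_const_over_n])
    have "\<bar>y n - u n\<bar> \<le> \<bar>B\<bar>" for n using bound[of n] by linarith
    then show "\<forall>\<^sub>F n in sequentially. norm ((y n - u n) / real n) \<le> norm (B / real n) * 1"
      by (intro always_eventually allI) (simp add: divide_right_mono)
  qed
  from tendsto_add[OF this assms(1)] show ?thesis by (simp add: diff_divide_distrib)
qed

lemma F_minus_add_int: "F_minus a b (x + of_int k) = F_minus a b x + of_int k"
  by (simp add: F_minus_def algebra_simps)

lemma F_minus_iter_add_int: "(F_minus a b ^^ n) (x + of_int k) = (F_minus a b ^^ n) x + of_int k"
  by (induction n) (simp_all add: F_minus_add_int)

lemma mono_F_minus: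
  assumes "0 < a" "a < 1"
  shows "mono (F_minus a b)"
proof (rule monoI)
  fix x y :: real assume "x \<le> y"
  then have "a * x \<le> a * y" "(1 - a) * of_int \<lfloor>x\<rfloor> \<le> (1 - a) * of_int \<lfloor>y\<rfloor>"
    using assms by (auto intro!: mult_left_mono floor_mono)
  then show "F_minus a b x \<le> F_minus a b y" by (simp add: F_minus_def)
qed

text \<open>The term \<open>- \<lfloor>1 - x\<rfloor>\<close> is the ceiling of \<open>x\<close>
  minus 1: it equals \<open>\<lfloor>x\<rfloor>\<close> off the integers and is one less at
  them.\<close>

lemma F_plus_le_F_minus:
  assumes "a < 1"
  shows "F_plus a b x \<le> F_minus a b x"
proof -
  have "- \<lfloor>1 - x\<rfloor> \<le> \<lfloor>x\<rfloor>" by linarith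
  then have "of_int (- \<lfloor>1 - x\<rfloor>) \<le> (of_int \<lfloor>x\<rfloor> :: real)" by (simp only: of_int_le_iff)
  then have "(1 - a) * of_int (- \<lfloor>1 - x\<rfloor>) \<le> (1 - a) * of_int \<lfloor>x\<rfloor>"
    using assms by (intro mult_left_mono) auto
  then show ?thesis by (simp add: F_plus_def F_minus_def)
qed

lemma F_minus_less_F_plus:
  assumes "0 < a" "a < 1" "x < y"
  shows "F_minus a b x < F_plus a b y"
proof -
  have "\<lfloor>x\<rfloor> \<le> - \<lfloor>1 - y\<rfloor>" using assms(3) by linarith
  then have "(of_int \<lfloor>x\<rfloor> :: real) \<le> of_int (- \<lfloor>1 - y\<rfloor>)" by (simp only: of_int_le_iff)
  then have "(1 - a) * of_int \<lfloor>x\<rfloor> \<le> (1 - a) * of_int (- \<lfloor>1 - y\<rfloor>)"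
    using assms by (intro mult_left_mono) auto
  moreover have "a * x < a * y" using assms by simp
  ultimately show ?thesis by (simp add: F_plus_def F_minus_def)
qed

lemma F_minus_le_add:
  assumes "a < 1"
  shows "F_minus a b x \<le> x + b"
proof -
  have "(1 - a) * of_int \<lfloor>x\<rfloor> \<le> (1 - a) * x" using assms by (intro mult_left_mono) auto
  then show ?thesis by (simp add: F_minus_def algebra_simps)
qed

text \<open>Rounding \<open>t\<close> to the integers around it traps the \<open>m\<close>-th
  iterate at \<open>t\<close> between two integer translates of the \<open>m\<close>-th iterate at
  0, which differ by 1.\<close>

lemma F_minus_iter_0_quasi_additive:
  assumes "0 < a" "a < 1"
  shows "\<bar>(F_minus a b ^^ (m + n)) 0 - (F_minus a b ^^ m) 0 - (F_minus a b ^^ n) 0\<bar> \<le> 1"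
proof -
  define t where "t = (F_minus a b ^^ n) 0"
  have iter_mono: "mono (F_minus a b ^^ m)" by (intro mono_pow mono_F_minus assms)
  have "(F_minus a b ^^ m) (0 + of_int \<lfloor>t\<rfloor>) \<le> (F_minus a b ^^ m) t"
    by (rule monoD[OF iter_mono]) linarith
  moreover have "(F_minus a b ^^ m) t \<le> (F_minus a b ^^ m) (0 + of_int (\<lfloor>t\<rfloor> + 1))"
    by (rule monoD[OF iter_mono]) linarith
  moreover have "(F_minus a b ^^ (m + n)) 0 = (F_minus a b ^^ m) t"
    by (simp add: funpow_add t_def)
  ultimately show ?thesis
    unfolding F_minus_iter_add_int t_def[symmetric] by linarith
qed

text \<open>The sequence is squeezed between two integer translates of the \<open>F_minus\<close>
  orbit of 0, whichever lift is chosen at each step.\<close>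

lemma lifted_orbit_near_F_minus_iter:
  assumes a: "0 < a" "a < 1"
    and y: "\<And>n. y (Suc n) \<in> {F_minus a b (y n), F_plus a b (y n)}"
  shows "\<bar>y n - (F_minus a b ^^ n) 0\<bar> \<le> \<bar>y 0\<bar> + 2"
proof -
  have upper: "y n \<le> (F_minus a b ^^ n) (0 + of_int (\<lfloor>y 0\<rfloor> + 1))"
  proof (induction n)
    case 0
    show ?case by simp
  next
    case (Suc n)
    have "y (Suc n) \<le> F_minus a b (y n)" using y[of n] F_plus_le_F_minus[OF a(2)] by auto
    also have "\<dots> \<le> F_minus a b ((F_minus a b ^^ n) (0 + of_int (\<lfloor>y 0\<rfloor> + 1)))"
      by (rule monoD[OF mono_F_minus[OF a] Suc.IH])
    finally show ?case by simp
  qed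
  \<comment> \<open>The invariant has to be strict, since at an integer \<open>F_plus\<close> lies
    below \<open>F_minus\<close>; hence the start one below the floor.\<close>
  have lower: "(F_minus a b ^^ n) (0 + of_int (\<lfloor>y 0\<rfloor> - 1)) < y n"
  proof (induction n)
    case 0
    show ?case by simp linarith
  next
    case (Suc n)
    have "F_minus a b ((F_minus a b ^^ n) (0 + of_int (\<lfloor>y 0\<rfloor> - 1))) < F_plus a b (y n)"
      by (rule F_minus_less_F_plus[OF a Suc.IH])
    also have "\<dots> \<le> y (Suc n)" using y[of n] F_plus_le_F_minus[OF a(2), of b "y n"] by auto
    finally show ?case by simp
  qed
  show ?thesis using upper lower unfolding F_minus_iter_add_int by linarith
qed

lemma F_minus_iter_0_bounds:
  assumes "0 < a" "a < 1" "0 \<le> b"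
  shows "0 \<le> (F_minus a b ^^ n) 0" and "(F_minus a b ^^ n) 0 \<le> b * real n"
proof -
  show "0 \<le> (F_minus a b ^^ n) 0"
  proof (induction n)
    case (Suc n)
    have "F_minus a b 0 \<le> F_minus a b ((F_minus a b ^^ n) 0)"
      by (rule monoD[OF mono_F_minus[OF assms(1,2)] Suc.IH])
    moreover have "F_minus a b 0 = b" by (simp add: F_minus_def)
    ultimately show ?case using assms(3) by simp
  qed simp
  show "(F_minus a b ^^ n) 0 \<le> b * real n"
  proof (induction n)
    case (Suc n)
    then show ?case using F_minus_le_add[OF assms(2), of b "(F_minus a b ^^ n) 0"]
      by (simp add: algebra_simps)
  qed simp
qed

text \<open>Iterating one lift alone is a special lifted orbit, so every starting point and both
  lifts share the rate of the orbit of 0. This rate lies between 0 and \<open>b\<close>, hence below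
  1.\<close>

lemma is_rotation_number_rotation_number:
  assumes "0 < a" "a < 1" "0 \<le> b" "b < 1"
  shows "is_rotation_number a b (rotation_number a b)"
proof -
  obtain r where r: "(\<lambda>n. (F_minus a b ^^ n) 0 / real n) \<longlonglongrightarrow> r"
    using quasi_additive_convergent[of "\<lambda>n. (F_minus a b ^^ n) 0" 1]
      F_minus_iter_0_quasi_additive[OF assms(1,2)]
    unfolding convergent_def by blast
  have "0 \<le> r"
    using r F_minus_iter_0_bounds(1)[OF assms(1-3)] by (intro LIMSEQ_le_const) auto
  moreover have "r \<le> b"
  proof (rule LIMSEQ_le_const2[OF r], intro exI allI impI)
    fix n :: nat assume "n \<ge> 1"
    then show "(F_minus a b ^^ n) 0 / real n \<le> b"
      using F_minus_iter_0_bounds(2)[OF assms(1-3), of n] by (simp add: divide_le_eq)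
  qed
  moreover have "(\<lambda>n. (F_minus a b ^^ n) x / real n) \<longlonglongrightarrow> r" for x
    by (rule bounded_distance_same_rate[OF r lifted_orbit_near_F_minus_iter[OF assms(1,2)]]) simp
  moreover have "(\<lambda>n. (F_plus a b ^^ n) x / real n) \<longlonglongrightarrow> r" for x
    by (rule bounded_distance_same_rate[OF r lifted_orbit_near_F_minus_iter[OF assms(1,2)]]) simp
  ultimately have "is_rotation_number a b r"
    using assms unfolding is_rotation_number_def by auto
  then show ?thesis
    unfolding rotation_number_def
    by (rule theI) (use r in \<open>auto simp: is_rotation_number_def intro: LIMSEQ_unique\<close>)
qed

lemma lifted_orbit_rotation_number:
  assumes "0 < a" "a < 1" "0 \<le> b" "b < 1"
    and "\<And>n. y (Suc n) \<in> {F_minus a b (y n), F_plus a b (y n)}"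
  shows "(\<lambda>n. y n / real n) \<longlonglongrightarrow> rotation_number a b"
proof (rule bounded_distance_same_rate)
  show "(\<lambda>n. (F_minus a b ^^ n) 0 / real n) \<longlonglongrightarrow> rotation_number a b"
    using is_rotation_number_rotation_number[OF assms(1-4)] unfolding is_rotation_number_def by blast
  show "\<bar>y n - (F_minus a b ^^ n) 0\<bar> \<le> \<bar>y 0\<bar> + 2" for n
    using assms(1,2,5) by (rule lifted_orbit_near_F_minus_iter)
qed

text \<open>The choice of lift depends only on whether \<open>x = 1\<close>, not on the branch of
  \<open>f_pm\<close> taken: the two branches agree modulo 1, and the integer goes into the next
  \<open>k\<close>.\<close>

lemma lift_step:
  assumes "0 \<le> x" "x \<le> 1"
  shows "a * x + b + of_int k \<in> {F_minus a b (x + of_int k), F_plus a b (x + of_int k)}"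
proof (cases "x = 1")
  case True
  have "\<lfloor>1 - (x + of_int k)\<rfloor> = - k" using True by simp
  then show ?thesis using True by (simp add: F_plus_def algebra_simps)
next
  case False
  then have "\<lfloor>x\<rfloor> = 0" using assms by (simp add: floor_eq_iff)
  then show ?thesis by (simp add: F_minus_add_int) (simp add: F_minus_def)
qed

lemma f_pm_diff_int:
  assumes "z \<in> f_pm a b x"
  obtains k :: int where "z = a * x + b - of_int k"
proof -
  have "z = a * x + b - of_int \<lfloor>a * x + b\<rfloor> \<or> z = a * x + b - of_int (- 1 - \<lfloor>- (a * x + b)\<rfloor>)"
    using assms by (auto simp: f_pm_def f_minus_def f_plus_def frac_plus_def frac_def)
  then show thesis using that by blast
qed

theorem theorem5p1:
  fixes a b :: real and x :: "nat \<Rightarrow> real"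
  assumes "0 < a" and "a < 1" and "0 \<le> b" and "b < 1"
    and "is_orbit a b x"
  shows "(\<lambda>n. (\<Sum>i<n. x i) / real n) \<longlonglongrightarrow> (b - rotation_number a b) / (1 - a)"
proof -
  have x01: "0 \<le> x n" "x n \<le> 1" and "x (Suc n) \<in> f_pm a b (x n)" for n
    using assms(5) by (auto simp: is_orbit_def)
  then have "\<forall>n. \<exists>k :: int. x (Suc n) = a * x n + b - of_int k"
    using f_pm_diff_int by meson
  then obtain k :: "nat \<Rightarrow> int" where k: "\<And>n. x (Suc n) = a * x n + b - of_int (k n)"
    by metis
  define y where "y n = x n + of_int (\<Sum>i<n. k i)" for n
  have "y (Suc n) = a * x n + b + of_int (\<Sum>i<n. k i)" for n
    by (simp add: y_def k)
  then have "y (Suc n) \<in> {F_minus a b (y n), F_plus a b (y n)}" for n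
    using lift_step[OF x01, of a n b "\<Sum>i<n. k i"] unfolding y_def[of n] by simp
  then have rate: "(\<lambda>n. y n / real n) \<longlonglongrightarrow> rotation_number a b"
    by (rule lifted_orbit_rotation_number[OF assms(1-4)])
  \<comment> \<open>Telescoping: \<open>y (Suc n) - y n = b - (1 - a) * x n\<close>.\<close>
  have sum_eq: "(1 - a) * (\<Sum>i<n. x i) = x 0 + b * real n - y n" for n
  proof (induction n)
    case (Suc n)
    then show ?case by (simp add: y_def k algebra_simps)
  qed (simp add: y_def)
  have "(\<lambda>n. (x 0 / real n + b - y n / real n) / (1 - a))
      \<longlonglongrightarrow> (0 + b - rotation_number a b) / (1 - a)"
    using assms(2) by (intro tendsto_intros rate lim_const_over_n) simp
  moreover have "\<forall>\<^sub>F n in sequentially.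
      (x 0 / real n + b - y n / real n) / (1 - a) = (\<Sum>i<n. x i) / real n"
  \<comment> \<open>At \<open>n = 0\<close> division by zero makes the left side
    \<open>b / (1 - a)\<close> and the right side 0, so the equality is claimed from 1 on.\<close>
  proof (rule eventually_sequentiallyI)
    fix n :: nat assume "1 \<le> n"
    then have "(x 0 / real n + b - y n / real n) / (1 - a)
        = (x 0 + b * real n - y n) / ((1 - a) * real n)"
      using assms(2) by (simp add: field_simps)
    then show "(x 0 / real n + b - y n / real n) / (1 - a) = (\<Sum>i<n. x i) / real n"
      using assms(2) unfolding sum_eq[symmetric] by simp
  qed
  ultimately show ?thesis by (simp add: Lim_transform_eventually)
qed

end
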